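(* For a finite abelian group $G$, the intersection hypergraph and the co-maximal hypergraph of $G$ are isomorphic: $\tilde{\Gamma}_{\mathcal{H}}(G) \cong Co_{\mathcal{H}}(G)$.
   Context: A hypergraph $\mathcal{H}$ is a pair $(V(\mathcal{H}),E(\mathcal{H}))$ where $V(\mathcal{H})$ is a set of vertices and $E(\mathcal{H})$ is a set of subsets of $V(\mathcal{H})$, called hyperedges. Two hypergraphs $\mathcal{H}_1,\mathcal{H}_2$ are isomorphic, written $\mathcal{H}_1\cong\mathcal{H}_2$, if there is a bijection between their vertex sets such that any subset of vertices is a hyperedge of $\mathcal{H}_1$ if and only if the corresponding subset is a hyperedge of $\mathcal{H}_2$. Let $G$ be a group with identity $e$ and let $S$ be the set of all non-trivial proper subgroups of $G$. The intersection hypergraph $\tilde{\Gamma}_{\mathcal{H}}(G)$ has vertex set $V=\{H\in S : H\cap K=\{e\} \text{ for some } K\in S\}$, and $E\subseteq V$ is a hyperedge if and only if (1) for distinct $H,K\in E$, $H\cap K=\{e\}$; and (2) there is no $E'\subseteq V$ with $E'\supsetneq E$ satisfying (1). The co-maximal hypergraph $Co_{\mathcal{H}}(G)$ has vertex set $V=\{H\in S : HK=G \text{ for some } K\in S\}$, and $E\subseteq V$ is a hyperedge if and only if (1) for distinct $H,K\in E$, $HK=G$; and (2) there is no $E'\subseteq V$ with $E'\supsetneq E$ satisfying (1). *)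

theory Defs
  imports "HOL-Algebra.Coset"
begin

record 'v hypergraph =
  vertices :: "'v set"
  hyperedges :: "'v set set"

definition wf_hypergraph :: "'v hypergraph \<Rightarrow> bool" where
  "wf_hypergraph H \<longleftrightarrow> hyperedges H \<subseteq> Pow (vertices H)"

definition hypergraph_iso :: "'v hypergraph \<Rightarrow> 'w hypergraph \<Rightarrow> bool" where
  "hypergraph_iso H1 H2 \<longleftrightarrow>
     (\<exists>f. bij_betw f (vertices H1) (vertices H2) \<and>
          (\<forall>A \<subseteq> vertices H1. A \<in> hyperedges H1 \<longleftrightarrow> f ` A \<in> hyperedges H2))"

definition nontrivial_proper_subgroups :: "('a, 'b) monoid_scheme \<Rightarrow> 'a set set" where
  "nontrivial_proper_subgroups G =
     {H. subgroup H G \<and> H \<noteq> {\<one>\<^bsub>G\<^esub>} \<and> H \<noteq> carrier G}"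

definition intersection_vertices :: "('a, 'b) monoid_scheme \<Rightarrow> 'a set set" where
  "intersection_vertices G =
     {H \<in> nontrivial_proper_subgroups G.
        \<exists>K \<in> nontrivial_proper_subgroups G. H \<inter> K = {\<one>\<^bsub>G\<^esub>}}"

definition intersection_hypergraph :: "('a, 'b) monoid_scheme \<Rightarrow> 'a set hypergraph" where
  "intersection_hypergraph G =
     \<lparr> vertices = intersection_vertices G,
       hyperedges =
         {E. E \<subseteq> intersection_vertices G \<and>
             pairwise (\<lambda>H K. H \<inter> K = {\<one>\<^bsub>G\<^esub>}) E \<and>
             \<not> (\<exists>E'. E' \<subseteq> intersection_vertices G \<and> E \<subset> E' \<and>
                    pairwise (\<lambda>H K. H \<inter> K = {\<one>\<^bsub>G\<^esub>}) E')} \<rparr>"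

definition comaximal_vertices :: "('a, 'b) monoid_scheme \<Rightarrow> 'a set set" where
  "comaximal_vertices G =
     {H \<in> nontrivial_proper_subgroups G.
        \<exists>K \<in> nontrivial_proper_subgroups G. H <#>\<^bsub>G\<^esub> K = carrier G}"

definition comaximal_hypergraph :: "('a, 'b) monoid_scheme \<Rightarrow> 'a set hypergraph" where
  "comaximal_hypergraph G =
     \<lparr> vertices = comaximal_vertices G,
       hyperedges =
         {E. E \<subseteq> comaximal_vertices G \<and>
             pairwise (\<lambda>H K. H <#>\<^bsub>G\<^esub> K = carrier G) E \<and>
             \<not> (\<exists>E'. E' \<subseteq> comaximal_vertices G \<and> E \<subset> E' \<and>
                    pairwise (\<lambda>H K. H <#>\<^bsub>G\<^esub> K = carrier G) E')} \<rparr>"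

lemma wf_intersection_hypergraph: "wf_hypergraph (intersection_hypergraph G)"
  by (auto simp: wf_hypergraph_def intersection_hypergraph_def)

lemma wf_comaximal_hypergraph: "wf_hypergraph (comaximal_hypergraph G)"
  by (auto simp: wf_hypergraph_def comaximal_hypergraph_def)

end

(* The subgroup lattice of a finite abelian group has an inclusion-reversing involution H |-> H^perp,
   which exchanges "trivial intersection" with "the product is everything", so it maps one
   hypergraph onto the other. The involution is taken with respect to a symmetric perfect pairing
   G x G -> Z/N, N = |G|. Every Z/N-valued character of a subgroup extends to G because N kills G;
   hence characters separate points from subgroups, and perp is an involution. The pairing is built
   by splitting off cyclic factors: if a value chi(a) = d > 0 is minimal among the values of all
   characters on all elements, then G is the direct product of <a> and ker chi. *)

theory Submission
  imports Defs "HOL-Algebra.Generated_Groups" "HOL-Algebra.Multiplicative_Group" "HOL-Number_Theory.Cong"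
begin

section \<open>Characters modulo \<open>N\<close> and pairings\<close>

text \<open>Characters with values in \<open>\<int>/N\<close> are represented by integer-valued functions read modulo \<open>N\<close>.\<close>

definition mod_character :: "('a, 'b) monoid_scheme \<Rightarrow> int \<Rightarrow> 'a set \<Rightarrow> ('a \<Rightarrow> int) \<Rightarrow> bool" where
  "mod_character G N H c \<longleftrightarrow> (\<forall>x\<in>H. \<forall>y\<in>H. [c (x \<otimes>\<^bsub>G\<^esub> y) = c x + c y] (mod N))"

lemma mod_characterD:
  "mod_character G N H c \<Longrightarrow> x \<in> H \<Longrightarrow> y \<in> H \<Longrightarrow> [c (x \<otimes>\<^bsub>G\<^esub> y) = c x + c y] (mod N)"
  by (simp add: mod_character_def)

lemma mod_character_subset:
  "mod_character G N H c \<Longrightarrow> K \<subseteq> H \<Longrightarrow> mod_character G N K c"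
  by (auto simp: mod_character_def)

text \<open>Perfectness is encoded as surjectivity of \<open>y\<close> |-> \<open>\<beta> y\<close>
  onto the characters of \<open>K\<close>. This is the half that turns a separating character into
  an element, as the double orthogonal complement requires.\<close>

definition perfect_pairing ::
  "('a, 'b) monoid_scheme \<Rightarrow> int \<Rightarrow> 'a set \<Rightarrow> ('a \<Rightarrow> 'a \<Rightarrow> int) \<Rightarrow> bool" where
  "perfect_pairing G N K \<beta> \<longleftrightarrow>
    (\<forall>x\<in>K. \<forall>y\<in>K. [\<beta> x y = \<beta> y x] (mod N)) \<and>
    (\<forall>y\<in>K. mod_character G N K (\<beta> y)) \<and>
    (\<forall>c. mod_character G N K c \<longrightarrow> (\<exists>y\<in>K. \<forall>x\<in>K. [c x = \<beta> y x] (mod N)))"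

lemma perfect_pairing_sym:
  "perfect_pairing G N K \<beta> \<Longrightarrow> x \<in> K \<Longrightarrow> y \<in> K \<Longrightarrow> [\<beta> x y = \<beta> y x] (mod N)"
  unfolding perfect_pairing_def by blast

lemma perfect_pairing_character:
  "perfect_pairing G N K \<beta> \<Longrightarrow> y \<in> K \<Longrightarrow> mod_character G N K (\<beta> y)"
  unfolding perfect_pairing_def by blast

lemma perfect_pairing_represents:
  "perfect_pairing G N K \<beta> \<Longrightarrow> mod_character G N K c \<Longrightarrow> \<exists>y\<in>K. \<forall>x\<in>K. [c x = \<beta> y x] (mod N)"
  unfolding perfect_pairing_def by blast

section \<open>Powers, kernels and relative orders\<close>

context group
begin

lemma mod_character_one:
  assumes "subgroup H G" "mod_character G N H c"
  shows "[c \<one> = 0] (mod N)"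
proof -
  have "[c (\<one> \<otimes> \<one>) = c \<one> + c \<one>] (mod N)"
    using assms by (intro mod_characterD) (auto simp: subgroup.one_closed)
  then show ?thesis
    by (simp add: cong_iff_dvd_diff)
qed

lemma mod_character_int_pow:
  assumes H: "subgroup H G" and c: "mod_character G N H c" and x: "x \<in> H"
  shows "[c (x [^] (i::int)) = i * c x] (mod N)"
proof -
  have xG: "x \<in> carrier G" using H x by (rule subgroup.mem_carrier)
  have step: "[c (x [^] (j + 1)) = c (x [^] j) + c x] (mod N)" for j :: int
    using mod_characterD[OF c subgroup_int_pow_closed[OF H x, of j] x]
      int_pow_mult[OF xG, of j 1] xG by simp
  show ?thesis
  proof (induction i rule: int_induct[where k = 0])
    case base
    then show ?case using mod_character_one[OF H c] by simp
  next
    case (step1 i)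
    have "[c (x [^] (i + 1)) = i * c x + c x] (mod N)"
      using step[of i] step1.IH by (meson cong_add cong_refl cong_trans)
    then show ?case by (simp add: algebra_simps)
  next
    case (step2 i)
    have "[c (x [^] (i - 1)) + c x = (i - 1) * c x + c x] (mod N)"
      using step[of "i - 1"] step2.IH by (simp add: algebra_simps) (meson cong_sym cong_trans)
    then show ?case using cong_add_rcancel by blast
  qed
qed

text \<open>Serves twice: for the complement \<open>L\<close> when a cyclic factor is split off, and
  for orthogonal complements, which are intersections of such kernels.\<close>

lemma mod_character_kernel:
  assumes H: "subgroup H G" and c: "mod_character G N H c"
  shows "subgroup {x \<in> H. [c x = 0] (mod N)} G"
proof
  show "{x \<in> H. [c x = 0] (mod N)} \<subseteq> carrier G" using subgroup.subset[OF H] by blast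
  show "\<one> \<in> {x \<in> H. [c x = 0] (mod N)}"
    using mod_character_one[OF H c] subgroup.one_closed[OF H] by simp
  fix x assume x: "x \<in> {x \<in> H. [c x = 0] (mod N)}"
  have "[c (x [^] (- 1 :: int)) = - 1 * c x] (mod N)"
    using x by (intro mod_character_int_pow[OF H c]) simp
  moreover have "x [^] (- 1 :: int) = inv x"
    using x subgroup.mem_carrier[OF H] int_pow_neg[of x 1] by simp
  ultimately show "inv x \<in> {x \<in> H. [c x = 0] (mod N)}"
    using x subgroup.m_inv_closed[OF H] by (auto simp: cong_iff_dvd_diff dvd_add_left_iff)
  fix y assume y: "y \<in> {x \<in> H. [c x = 0] (mod N)}"
  have "[c (x \<otimes> y) = c x + c y] (mod N)" using x y by (intro mod_characterD[OF c]) auto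
  also have "[c x + c y = 0 + 0] (mod N)" using x y by (intro cong_add) auto
  finally show "x \<otimes> y \<in> {x \<in> H. [c x = 0] (mod N)}"
    using x y subgroup.m_closed[OF H] by simp
qed

text \<open>The exponents \<open>i\<close> with \<open>g [^] i\<close> in \<open>H\<close> form an
  ideal of the integers, nonzero because it contains the order of the group; \<open>m\<close> is its
  positive generator. It is the order of the coset of \<open>g\<close> modulo \<open>H\<close>, and
  the order of \<open>g\<close> itself when \<open>H\<close> is trivial.\<close>

lemma subgroup_relative_order:
  assumes fin: "finite (carrier G)" and H: "subgroup H G" and g: "g \<in> carrier G"
  obtains m :: int where "m > 0" "\<And>i::int. g [^] i \<in> H \<longleftrightarrow> m dvd i"
proof -
  define P where "P k \<longleftrightarrow> k > 0 \<and> g [^] int k \<in> H" for k :: nat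
  have "P (order G)"
    using fin g pow_order_eq_1[OF g] H
    by (auto simp: P_def int_pow_int order_gt_0_iff_finite subgroup.one_closed)
  define k where "k = (LEAST k. P k)"
  have Pk: "P k" unfolding k_def using \<open>P (order G)\<close> by (rule LeastI)
  have le: "k \<le> j" if "P j" for j unfolding k_def using that by (rule Least_le)
  have mult: "g [^] (int k * q) \<in> H" for q :: int
    using subgroup_int_pow_closed[OF H, of "g [^] int k" q] Pk g
    by (simp add: P_def int_pow_pow)
  \<comment> \<open>Division with remainder: the remainder of \<open>i\<close> modulo
    \<open>k\<close> is again an exponent leading into \<open>H\<close>, so by minimality of
    \<open>k\<close> it vanishes.\<close>
  have "int k dvd i" if "g [^] i \<in> H" for i :: int
  proof -
    have "g [^] (i mod int k) = g [^] i \<otimes> g [^] (int k * (- (i div int k)))"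
      using int_pow_mult[OF g, of i "int k * (- (i div int k))"]
      by (simp add: minus_div_mult_eq_mod[symmetric] algebra_simps)
    then have "g [^] (i mod int k) \<in> H"
      using subgroup.m_closed[OF H that mult[of "- (i div int k)"]] by simp
    moreover have "i mod int k < int k" "0 \<le> i mod int k" using Pk by (auto simp: P_def)
    ultimately have "i mod int k = 0"
      using le[unfolded P_def, of "nat (i mod int k)"]
      by (metis int_nat_eq le_less linorder_not_le nat_less_eq_zless of_nat_0_less_iff nat_int)
    then show ?thesis by presburger
  qed
  then have "g [^] i \<in> H \<longleftrightarrow> int k dvd i" for i :: int
    using mult by (auto elim!: dvdE)
  then show ?thesis using that[of "int k"] Pk by (auto simp: P_def)
qed

end

section \<open>Extension of characters and separation of points from subgroups\<close>

context comm_group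
begin

lemma subgroup_adjoin:
  assumes H: "subgroup H G" and g: "g \<in> carrier G"
  shows "subgroup {h \<otimes> g [^] (i::int) | h i. h \<in> H} G" (is "subgroup ?K G")
proof
  note HG = subgroup.mem_carrier[OF H]
  show "?K \<subseteq> carrier G" using g HG by auto
  show "\<one> \<in> ?K" using subgroup.one_closed[OF H] by (force intro: exI[of _ "0::int"])
  fix x assume "x \<in> ?K"
  then obtain h i where x: "x = h \<otimes> g [^] (i::int)" "h \<in> H" by auto
  have "inv x = inv h \<otimes> g [^] (- i)"
    using x g HG by (simp add: inv_mult int_pow_neg)
  then show "inv x \<in> ?K" using subgroup.m_inv_closed[OF H] x(2) by blast
  fix y assume "y \<in> ?K"
  then obtain k j where y: "y = k \<otimes> g [^] (j::int)" "k \<in> H" by auto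
  have "x \<otimes> y = (h \<otimes> k) \<otimes> g [^] (i + j)"
    using x y g HG by (simp add: int_pow_mult m_ac)
  then show "x \<otimes> y \<in> ?K" using subgroup.m_closed[OF H] x(2) y(2) by blast
qed

text \<open>The candidate is \<open>h \<otimes> g [^] i\<close> |-> \<open>c h + i * v\<close>. Two
  such expressions for one element have exponents differing by a multiple of \<open>m\<close>, so
  the only constraint on the new value \<open>v\<close> is the one imposed by
  \<open>g [^] m\<close>.\<close>

lemma mod_character_adjoin:
  assumes H: "subgroup H G" and g: "g \<in> carrier G" and c: "mod_character G N H c"
    and m: "\<And>i::int. g [^] i \<in> H \<longleftrightarrow> m dvd i"
    and v: "[m * v = c (g [^] m)] (mod N)"
  obtains c' where "mod_character G N {h \<otimes> g [^] (i::int) | h i. h \<in> H} c'"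
    "\<forall>h\<in>H. [c' h = c h] (mod N)" "[c' g = v] (mod N)"
proof -
  note HG = subgroup.mem_carrier[OF H]
  \<comment> \<open>Independence of the chosen expression: if \<open>j - i = m * q\<close>, then
    \<open>h\<close> is \<open>k\<close> times the \<open>q\<close>-th power of
    \<open>g [^] m\<close>, and the hypothesis on \<open>v\<close> turns the resulting term into
    \<open>q * (m * v)\<close>, which is \<open>(j - i) * v\<close>.\<close>
  have wd: "[c h + i * v = c k + j * v] (mod N)"
    if hk: "h \<in> H" "k \<in> H" and eq: "h \<otimes> g [^] i = k \<otimes> g [^] j" for h k and i j :: int
  proof -
    have "h = (h \<otimes> g [^] i) \<otimes> g [^] (- i)"
      using hk g HG by (simp add: m_assoc int_pow_mult[symmetric])
    also have "\<dots> = k \<otimes> g [^] (j - i)"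
      unfolding eq using hk g HG by (simp add: m_assoc int_pow_mult[symmetric])
    finally have h: "h = k \<otimes> g [^] (j - i)" .
    then have "g [^] (j - i) = inv k \<otimes> h"
      using hk g HG by (simp add: m_assoc[symmetric])
    then have "g [^] (j - i) \<in> H"
      using hk H by (simp add: subgroup.m_closed subgroup.m_inv_closed)
    then obtain q where q: "j - i = m * q" using m by blast
    have gm: "g [^] m \<in> H" using m by simp
    have "[c h = c k + c ((g [^] m) [^] q)] (mod N)"
      unfolding h q using g int_pow_pow[OF g, of m q]
        mod_characterD[OF c hk(2) subgroup_int_pow_closed[OF H gm, of q]] by simp
    moreover have "[c ((g [^] m) [^] q) = q * c (g [^] m)] (mod N)"
      using mod_character_int_pow[OF H c gm] .
    moreover have "[q * c (g [^] m) = q * (m * v)] (mod N)"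
      using v by (intro cong_mult cong_refl) (rule cong_sym)
    ultimately have "[c h = c k + q * (m * v)] (mod N)"
      by (meson cong_add cong_refl cong_trans)
    then have "[c h + i * v = c k + q * (m * v) + i * v] (mod N)"
      by (intro cong_add cong_refl)
    moreover have "c k + q * (m * v) + i * v = c k + j * v"
    proof -
      have "j = i + m * q" using q by simp
      then show ?thesis by (simp add: algebra_simps)
    qed
    ultimately show ?thesis by simp
  qed
  \<comment> \<open>An arbitrary expression of \<open>x\<close> is chosen; by \<open>wd\<close> the
    choice affects the value only by a multiple of \<open>N\<close>.\<close>
  define rep where "rep x p \<longleftrightarrow> fst p \<in> H \<and> x = fst p \<otimes> g [^] (snd p :: int)" for x p
  define c' where "c' x = c (fst (SOME p. rep x p)) + snd (SOME p. rep x p) * v" for x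
  have c': "[c' (h \<otimes> g [^] i) = c h + i * v] (mod N)" if h: "h \<in> H" for h i
  proof -
    let ?x = "h \<otimes> g [^] i"
    have "rep ?x (h, i)" using h by (simp add: rep_def)
    then have r: "rep ?x (SOME p. rep ?x p)" by (rule someI)
    show ?thesis
      unfolding c'_def using r[unfolded rep_def[of ?x "SOME p. rep ?x p"]] h by (intro wd) auto
  qed
  show ?thesis
  proof
    show "mod_character G N {h \<otimes> g [^] (i::int) | h i. h \<in> H} c'"
      unfolding mod_character_def
    proof clarify
      fix h k and i j :: int
      assume hk: "h \<in> H" "k \<in> H"
      have eq: "(h \<otimes> g [^] i) \<otimes> (k \<otimes> g [^] j) = (h \<otimes> k) \<otimes> g [^] (i + j)"
        using hk g HG by (simp add: int_pow_mult m_ac)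
      have "[c' ((h \<otimes> g [^] i) \<otimes> (k \<otimes> g [^] j)) = c (h \<otimes> k) + (i + j) * v] (mod N)"
        unfolding eq using hk H by (intro c') (simp add: subgroup.m_closed)
      also have "[c (h \<otimes> k) + (i + j) * v = (c h + c k) + (i + j) * v] (mod N)"
        using mod_characterD[OF c hk] by (intro cong_add cong_refl)
      also have "(c h + c k) + (i + j) * v = (c h + i * v) + (c k + j * v)"
        by (simp add: algebra_simps)
      also have "[\<dots> = c' (h \<otimes> g [^] i) + c' (k \<otimes> g [^] j)] (mod N)"
        using c' hk by (intro cong_add cong_sym[OF c'])
      finally show "[c' ((h \<otimes> g [^] i) \<otimes> (k \<otimes> g [^] j)) =
        c' (h \<otimes> g [^] i) + c' (k \<otimes> g [^] j)] (mod N)" .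
    qed
    show "\<forall>h\<in>H. [c' h = c h] (mod N)"
      using c'[where i = 0] HG by simp
    have "[c' g = c \<one> + v] (mod N)"
      using c'[of \<one> 1] subgroup.one_closed[OF H] g by simp
    also have "[c \<one> + v = 0 + v] (mod N)"
      using mod_character_one[OF H c] by (intro cong_add cong_refl)
    finally show "[c' g = v] (mod N)" by simp
  qed
qed

lemma subset_adjoin:
  assumes H: "subgroup H G" and g: "g \<in> carrier G"
  shows "insert g H \<subseteq> {h \<otimes> g [^] (i::int) | h i. h \<in> H}"
proof clarify
  fix x assume x: "x \<in> insert g H"
  have "g = \<one> \<otimes> g [^] (1::int)" using g by simp
  moreover have "h = h \<otimes> g [^] (0::int)" if "h \<in> H" for h
    using subgroup.mem_carrier[OF H that] by simp
  ultimately show "\<exists>h i. x = h \<otimes> g [^] (i::int) \<and> h \<in> H"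
    using x subgroup.one_closed[OF H] by blast
qed

text \<open>One element is adjoined at a time, which requires dividing \<open>c (g [^] m)\<close> by
  \<open>m\<close>. This is possible because \<open>N\<close> kills \<open>g\<close>: with
  \<open>N = m * q\<close>, the \<open>q\<close>-th power of \<open>g [^] m\<close> is trivial, so
  \<open>m * q\<close> divides \<open>q * c (g [^] m)\<close>.\<close>

lemma mod_character_extend:
  assumes fin: "finite (carrier G)" and N: "N > 0" "\<And>x. x \<in> carrier G \<Longrightarrow> x [^] (N::int) = \<one>"
    and H: "subgroup H G" and c: "mod_character G N H c"
  shows "\<exists>c'. mod_character G N (carrier G) c' \<and> (\<forall>h\<in>H. [c' h = c h] (mod N))"
  using H c
proof (induction "card (carrier G) - card H" arbitrary: H c rule: less_induct)
  case less
  note H = \<open>subgroup H G\<close> and c = \<open>mod_character G N H c\<close>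
  show ?case
  proof (cases "H = carrier G")
    case True
    then show ?thesis using c by (intro exI[of _ c]) simp
  next
    case False
    then obtain g where g: "g \<in> carrier G" "g \<notin> H"
      using subgroup.subset[OF H] by blast
    obtain m :: int where m: "m > 0" "\<And>i::int. g [^] i \<in> H \<longleftrightarrow> m dvd i"
      using subgroup_relative_order[OF fin H g(1)] by metis
    have "m dvd N" using m(2)[of N] N(2)[OF g(1)] subgroup.one_closed[OF H] by simp
    then obtain q where q: "N = m * q" by (rule dvdE)
    have gm: "g [^] m \<in> H" by (simp add: m(2))
    have "(g [^] m) [^] q = \<one>" using N(2)[OF g(1)] q g by (simp add: int_pow_pow)
    then have "[q * c (g [^] m) = 0] (mod N)"
      using mod_character_int_pow[OF H c gm, of q] mod_character_one[OF H c]
      by (simp add: cong_def)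
    then have "m dvd c (g [^] m)"
      using q N(1) dvd_mult_cancel_left[of q m "c (g [^] m)"] by (auto simp: cong_0_iff mult.commute)
    then obtain v where v: "m * v = c (g [^] m)" by (metis dvdE)
    let ?K = "{h \<otimes> g [^] (i::int) | h i. h \<in> H}"
    have "[m * v = c (g [^] m)] (mod N)" using v by simp
    then obtain c1 where c1: "mod_character G N ?K c1" "\<forall>h\<in>H. [c1 h = c h] (mod N)"
      "[c1 g = v] (mod N)"
      by (rule mod_character_adjoin[OF H g(1) c m(2)])
    have K: "subgroup ?K G" using subgroup_adjoin[OF H g(1)] .
    have sub: "insert g H \<subseteq> ?K" using subset_adjoin[OF H g(1)] .
    have "card H < card ?K"
      using sub g(2) finite_subset[OF subgroup.subset[OF K] fin] by (intro psubset_card_mono) auto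
    moreover have "card ?K \<le> card (carrier G)"
      using subgroup.subset[OF K] fin by (rule card_mono[rotated])
    ultimately have "card (carrier G) - card ?K < card (carrier G) - card H" by linarith
    then obtain c' where c': "mod_character G N (carrier G) c'" "\<forall>h\<in>?K. [c' h = c1 h] (mod N)"
      using less.hyps[OF _ K c1(1)] by blast
    have "[c' h = c h] (mod N)" if "h \<in> H" for h
    proof (rule cong_trans)
      show "[c' h = c1 h] (mod N)" using sub that c'(2) by blast
    qed (use c1(2) that in blast)
    then show ?thesis using c'(1) by blast
  qed
qed

text \<open>The zero character on \<open>H\<close> may be given the value \<open>N div m\<close> at
  \<open>g\<close>, since \<open>m\<close> times it is \<open>N\<close>; the result is then extended
  to the whole group. For \<open>g\<close> outside \<open>H\<close> one has \<open>m > 1\<close>, so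
  this value is nonzero modulo \<open>N\<close>.\<close>

lemma mod_character_separates:
  assumes fin: "finite (carrier G)" and N: "N > 0" "\<And>x. x \<in> carrier G \<Longrightarrow> x [^] (N::int) = \<one>"
    and H: "subgroup H G" and g: "g \<in> carrier G"
    and m: "m > 0" "\<And>i::int. g [^] i \<in> H \<longleftrightarrow> m dvd i"
  obtains c where "mod_character G N (carrier G) c" "\<And>h. h \<in> H \<Longrightarrow> [c h = 0] (mod N)"
    "m dvd N" "[c g = N div m] (mod N)"
proof -
  have mN: "m dvd N" using m(2)[of N] N(2)[OF g] subgroup.one_closed[OF H] by simp
  let ?K = "{h \<otimes> g [^] (i::int) | h i. h \<in> H}"
  have "mod_character G N H (\<lambda>_. 0)" by (simp add: mod_character_def)
  moreover have "[m * (N div m) = 0] (mod N)" using mN by (simp add: cong_0_iff)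
  ultimately obtain c1 where c1: "mod_character G N ?K c1" "\<forall>h\<in>H. [c1 h = 0] (mod N)"
    "[c1 g = N div m] (mod N)"
    by (rule mod_character_adjoin[OF H g _ m(2)])
  obtain c where c: "mod_character G N (carrier G) c" "\<forall>h\<in>?K. [c h = c1 h] (mod N)"
    using mod_character_extend[OF fin N subgroup_adjoin[OF H g] c1(1)] by blast
  have "\<And>h. h \<in> insert g H \<Longrightarrow> [c h = c1 h] (mod N)"
    using c(2) subset_adjoin[OF H g] by blast
  then show ?thesis
    using that[OF c(1) _ mN] c1(2,3) by (meson cong_trans insertCI)
qed

section \<open>Construction of a symmetric perfect pairing\<close>

text \<open>The pairing is an orthogonal sum: (\<open>a [^] i\<close>, \<open>a [^] j\<close>) |->
  \<open>d * i * j\<close> on the cyclic factor, with \<open>d\<close> equal to \<open>N\<close>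
  divided by the order of \<open>a\<close>, and the inductively given pairing on the kernel of
  \<open>\<chi>\<close>. Inducting over subgroups of one fixed group keeps the value group modulo
  \<open>N\<close> the same throughout.\<close>

lemma perfect_pairing_exists:
  assumes fin: "finite (carrier G)" and N: "N > 0" "\<And>x. x \<in> carrier G \<Longrightarrow> x [^] (N::int) = \<one>"
    and K: "subgroup K G"
  shows "\<exists>\<beta>. perfect_pairing G N K \<beta>"
  using K
proof (induction "card K" arbitrary: K rule: less_induct)
  case less
  note K = \<open>subgroup K G\<close>
  note KG = subgroup.mem_carrier[OF K] and Kone = subgroup.one_closed[OF K]
    and Kmult = subgroup.m_closed[OF K] and Kpow = subgroup_int_pow_closed[OF K]
  show ?case
  proof (cases "K = {\<one>}")
    case True
    have "[c \<one> = 0] (mod N)" if "mod_character G N {\<one>} c" for c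
      using mod_character_one[OF triv_subgroup that] .
    then have "perfect_pairing G N K (\<lambda>_ _. 0)"
      unfolding perfect_pairing_def True by (simp add: mod_character_def)
    then show ?thesis by blast
  next
    case False
    then obtain x0 where x0: "x0 \<in> K" "x0 \<noteq> \<one>" using Kone by blast
    define P where "P w \<longleftrightarrow> w > 0 \<and>
      (\<exists>c x. mod_character G N K c \<and> x \<in> K \<and> [c x = int w] (mod N))" for w :: nat
    define d where "d = int (LEAST w. P w)"
    have min: "d \<le> w" if "mod_character G N K c" "x \<in> K" "[c x = w] (mod N)" "w > 0" for c x w
    proof -
      have "P (nat w)" using that unfolding P_def by (auto intro!: exI[of _ c] exI[of _ x])
      then have "(LEAST w. P w) \<le> nat w" by (rule Least_le)
      then show ?thesis using that(4) by (simp add: d_def)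
    qed
    \<comment> \<open>An element of order \<open>m\<close> takes the value \<open>N div m\<close>
      under some character: separation from the trivial subgroup, restricted to
      \<open>K\<close>.\<close>
    have elt: "\<exists>m c. m > 0 \<and> m dvd N \<and> (\<forall>i::int. x [^] i = \<one> \<longleftrightarrow> m dvd i) \<and>
        mod_character G N K c \<and> [c x = N div m] (mod N)"
      if x: "x \<in> K" for x
    proof -
      obtain m :: int where m: "m > 0" "\<And>i::int. x [^] i \<in> {\<one>} \<longleftrightarrow> m dvd i"
        using subgroup_relative_order[OF fin triv_subgroup KG[OF x]] by metis
      obtain c where c: "mod_character G N (carrier G) c" "m dvd N" "[c x = N div m] (mod N)"
        using mod_character_separates[OF fin N triv_subgroup KG[OF x] m] by metis
      show ?thesis
        using m c mod_character_subset[OF c(1) subgroup.subset[OF K]]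
        by (intro exI[of _ m] exI[of _ c]) simp
    qed
    \<comment> \<open>The value 0 also has the positive representative \<open>N\<close>, so the
      minimum \<open>d\<close> must be shown to lie strictly below \<open>N\<close>. The nontrivial
      element \<open>x0\<close> provides such a value, since its order \<open>m0\<close> is not
      1.\<close>
    obtain m0 c0 where m0: "m0 > 0" "m0 dvd N" "\<forall>i::int. x0 [^] i = \<one> \<longleftrightarrow> m0 dvd i"
      "mod_character G N K c0" "[c0 x0 = N div m0] (mod N)"
      using elt[OF x0(1)] by metis
    have "m0 \<noteq> 1" using m0(3)[rule_format, of 1] x0 KG by auto
    then have v0: "0 < N div m0" "N div m0 < N"
      using m0(1,2) N(1) by (auto elim!: dvdE simp: zero_less_mult_iff)
    have "P (nat (N div m0))"
      using m0(4,5) x0(1) v0(1) unfolding P_def by (auto intro!: exI[of _ c0] exI[of _ x0])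
    then have "P (LEAST w. P w)" by (rule LeastI)
    then obtain \<chi> a where d: "d > 0" and \<chi>: "mod_character G N K \<chi>" and a: "a \<in> K"
      and \<chi>a: "[\<chi> a = d] (mod N)"
      unfolding P_def d_def by auto
    have "d < N" using min[OF m0(4) x0(1) m0(5) v0(1)] v0(2) by linarith
    have aG: "a \<in> carrier G" using a KG by blast
    have \<chi>apow: "[\<chi> (a [^] i) = i * d] (mod N)" for i :: int
      using mod_character_int_pow[OF K \<chi> a, of i] cong_mult[OF cong_refl \<chi>a] cong_trans by blast
    have \<chi>mult: "[\<chi> (x \<otimes> a [^] i) = \<chi> x + i * d] (mod N)" if "x \<in> K" for x and i :: int
      using mod_characterD[OF \<chi> that Kpow[OF a]] cong_add[OF cong_refl \<chi>apow] cong_trans by blast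
    \<comment> \<open>Multiplying \<open>x\<close> by a suitable power of \<open>a\<close> replaces
      the value of \<open>\<chi>\<close> by its remainder modulo \<open>d\<close>; a positive
      remainder would undercut the minimum.\<close>
    have d\<chi>: "d dvd \<chi> x" if x: "x \<in> K" for x
    proof (rule ccontr)
      assume "\<not> d dvd \<chi> x"
      then have pos: "\<chi> x mod d > 0" using d by (simp add: dvd_eq_mod_eq_0 order.not_eq_order_implies_strict)
      have "\<chi> x + (- (\<chi> x div d)) * d = \<chi> x mod d" by (simp add: minus_div_mult_eq_mod)
      then have "[\<chi> (x \<otimes> a [^] (- (\<chi> x div d))) = \<chi> x mod d] (mod N)"
        using \<chi>mult[OF x, of "- (\<chi> x div d)"] by simp
      from min[OF \<chi> Kmult[OF x Kpow[OF a]] this pos] show False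
        using d pos_mod_bound[of d "\<chi> x"] by linarith
    qed
    obtain m c1 where m: "m > 0" "m dvd N" "\<And>i::int. a [^] i = \<one> \<longleftrightarrow> m dvd i"
      and c1: "mod_character G N K c1" "[c1 a = N div m] (mod N)"
      using elt[OF a] by metis
    \<comment> \<open>Here \<open>m\<close> is the order of \<open>a\<close>. The value
      \<open>N div m\<close> is attained at \<open>a\<close>, so minimality bounds \<open>d\<close>
      by it; conversely \<open>\<chi>\<close> sends \<open>a [^] m\<close> to 0, so \<open>N\<close>
      divides \<open>m * d\<close>.\<close>
    have Nmd: "N = m * d"
    proof (rule antisym)
      have "N div m > 0" using m(1,2) N(1) by (auto elim!: dvdE simp: zero_less_mult_iff)
      then have "d \<le> N div m" using min[OF c1(1) a c1(2)] by simp
      then have "m * d \<le> m * (N div m)" using m(1) by simp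
      then show "m * d \<le> N" using m(2) by simp
      have "[\<chi> (a [^] m) = 0] (mod N)"
        using mod_character_one[OF K \<chi>] m(3)[of m] by simp
      then have "[m * d = 0] (mod N)" using \<chi>apow[of m] by (simp add: cong_def)
      then show "N \<le> m * d" using m(1) d by (simp add: cong_0_iff zdvd_imp_le)
    qed
    \<comment> \<open>\<open>x = a ^ q x * \<pi> x\<close> is the decomposition of \<open>K\<close> as the product of \<open>\<langle>a\<rangle>\<close> and \<open>L = ker \<chi>\<close>.\<close>
    define q where "q x = \<chi> x div d" for x
    define \<pi> where "\<pi> x = x \<otimes> a [^] (- q x)" for x
    define L where "L = {x \<in> K. [\<chi> x = 0] (mod N)}"
    have dq: "d * q x = \<chi> x" if "x \<in> K" for x using d\<chi>[OF that] by (simp add: q_def)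
    \<comment> \<open>Exponents of \<open>a\<close> matter modulo \<open>m\<close>, which after
      scaling by \<open>d\<close> is congruence modulo \<open>N\<close>. This is how congruences
      between character values become equations in the group.\<close>
    have apow_eq: "a [^] i = a [^] j" if "[d * i = d * j] (mod N)" for i j :: int
    proof -
      have "d * m dvd d * (i - j)"
        using that by (simp add: cong_iff_dvd_diff Nmd algebra_simps)
      then have "a [^] (i - j) = \<one>" using m(3) d by simp
      then show ?thesis using int_pow_mult[OF aG, of "i - j" j] aG by simp
    qed
    have L: "subgroup L G" unfolding L_def using mod_character_kernel[OF K \<chi>] .
    have LK: "L \<subseteq> K" by (auto simp: L_def)
    have \<pi>L: "\<pi> x \<in> L" if x: "x \<in> K" for x
      unfolding L_def \<pi>_def using \<chi>mult[OF x, of "- q x"] dq[OF x] Kmult[OF x Kpow[OF a]]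
      by (simp add: mult.commute)
    have "a \<notin> L"
    proof
      assume "a \<in> L"
      then have "[d = 0] (mod N)" using \<chi>a by (simp add: L_def cong_def)
      then show False using d \<open>d < N\<close> by (simp add: cong_0_iff zdvd_not_zless)
    qed
    then have "card L < card K"
      using LK a finite_subset[OF subgroup.subset[OF K] fin] by (intro psubset_card_mono) auto
    then obtain \<beta>' where \<beta>': "perfect_pairing G N L \<beta>'" using less.hyps L by blast
    \<comment> \<open>The map \<open>q\<close> is additive only modulo \<open>m\<close>, hence the
      factor \<open>d\<close> in the congruence modulo \<open>N\<close>.\<close>
    have dqmult: "[d * q (x \<otimes> y) = d * (q x + q y)] (mod N)" if "x \<in> K" "y \<in> K" for x y
      using mod_characterD[OF \<chi> that] dq that Kmult by (simp add: distrib_left)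
    have \<pi>mult: "\<pi> (x \<otimes> y) = \<pi> x \<otimes> \<pi> y" if "x \<in> K" "y \<in> K" for x y
    proof -
      have "[d * (- q (x \<otimes> y)) = d * (- q x + - q y)] (mod N)"
        using dqmult[OF that] by (simp add: cong_iff_dvd_diff algebra_simps dvd_diff_commute)
      then have "a [^] (- q (x \<otimes> y)) = a [^] (- q x) \<otimes> a [^] (- q y)"
        using apow_eq int_pow_mult[OF aG] by metis
      then show ?thesis using that KG aG by (simp add: \<pi>_def m_ac)
    qed
    define \<beta> where "\<beta> x y = d * q x * q y + \<beta>' (\<pi> x) (\<pi> y)" for x y
    have "perfect_pairing G N K \<beta>"
      unfolding perfect_pairing_def
    proof (intro conjI ballI allI impI)
      fix x y assume xy: "x \<in> K" "y \<in> K"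
      show "[\<beta> x y = \<beta> y x] (mod N)"
        unfolding \<beta>_def using perfect_pairing_sym[OF \<beta>' \<pi>L[OF xy(1)] \<pi>L[OF xy(2)]]
        by (intro cong_add) (simp_all add: ac_simps)
    next
      fix y assume y: "y \<in> K"
      show "mod_character G N K (\<beta> y)"
        unfolding mod_character_def
      proof (intro ballI)
        fix x z assume xz: "x \<in> K" "z \<in> K"
        have "[q y * (d * q (x \<otimes> z)) = q y * (d * (q x + q z))] (mod N)"
          using dqmult[OF xz] by (rule cong_mult[OF cong_refl])
        moreover have "[\<beta>' (\<pi> y) (\<pi> (x \<otimes> z)) = \<beta>' (\<pi> y) (\<pi> x) + \<beta>' (\<pi> y) (\<pi> z)] (mod N)"
          unfolding \<pi>mult[OF xz]
          using mod_characterD[OF perfect_pairing_character[OF \<beta>' \<pi>L[OF y]]] \<pi>L xz by blast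
        ultimately have "[q y * (d * q (x \<otimes> z)) + \<beta>' (\<pi> y) (\<pi> (x \<otimes> z)) =
            q y * (d * (q x + q z)) + (\<beta>' (\<pi> y) (\<pi> x) + \<beta>' (\<pi> y) (\<pi> z))] (mod N)"
          by (rule cong_add)
        then show "[\<beta> y (x \<otimes> z) = \<beta> y x + \<beta> y z] (mod N)"
          by (simp add: \<beta>_def algebra_simps)
      qed
    next
      fix c assume c: "mod_character G N K c"
      obtain y' where y': "y' \<in> L" "\<And>x. x \<in> L \<Longrightarrow> [c x = \<beta>' y' x] (mod N)"
        using perfect_pairing_represents[OF \<beta>' mod_character_subset[OF c LK]] by metis
      \<comment> \<open>Finding the element that represents \<open>c\<close>: \<open>y'\<close>
        handles the restriction to \<open>L\<close>. Since \<open>a [^] m\<close> is trivial,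
        \<open>m * d\<close> divides \<open>m * c a\<close>, so \<open>c a = d * j\<close>, and
        \<open>a [^] j\<close> handles the cyclic factor. The components of \<open>y\<close> are
        then \<open>q y\<close>, congruent to \<open>j\<close> modulo \<open>m\<close>, and
        \<open>\<pi> y = y'\<close>.\<close>
      have "[c (a [^] m) = 0] (mod N)" using mod_character_one[OF K c] m(3)[of m] by simp
      then have "[m * c a = 0] (mod N)"
        using mod_character_int_pow[OF K c a, of m] by (simp add: cong_def)
      then have "d dvd c a" using m(1) by (simp add: cong_0_iff Nmd)
      then obtain j where j: "c a = d * j" by (rule dvdE)
      define y where "y = y' \<otimes> a [^] j"
      have y'K: "y' \<in> K" using y'(1) LK by blast
      have y: "y \<in> K" unfolding y_def using Kmult[OF y'K Kpow[OF a]] .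
      have "[\<chi> y = \<chi> y' + j * d] (mod N)" unfolding y_def using \<chi>mult[OF y'K] .
      moreover have "[\<chi> y' + j * d = 0 + j * d] (mod N)"
        using y'(1) by (intro cong_add cong_refl) (simp add: L_def)
      ultimately have qy: "[d * q y = d * j] (mod N)"
        using dq[OF y] by (simp add: cong_def mult.commute)
      have \<pi>y: "\<pi> y = y'"
        unfolding \<pi>_def int_pow_neg[OF aG] apow_eq[OF qy]
        using KG[OF y'K] aG by (simp add: y_def m_assoc)
      have "[c x = \<beta> y x] (mod N)" if x: "x \<in> K" for x
      proof -
        have \<pi>x: "\<pi> x \<in> K" using \<pi>L[OF x] LK by blast
        have "\<pi> x \<otimes> a [^] q x = x"
          using KG[OF x] aG by (simp add: \<pi>_def m_assoc int_pow_mult[symmetric])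
        then have "[c x = c (\<pi> x) + c (a [^] q x)] (mod N)"
          using mod_characterD[OF c \<pi>x Kpow[OF a, of "q x"]] by simp
        also have "[c (\<pi> x) + c (a [^] q x) = \<beta>' y' (\<pi> x) + q x * c a] (mod N)"
          using y'(2)[OF \<pi>L[OF x]] mod_character_int_pow[OF K c a] by (rule cong_add)
        also have "[\<beta>' y' (\<pi> x) + q x * c a = \<beta>' y' (\<pi> x) + q x * (d * q y)] (mod N)"
          unfolding j by (rule cong_add[OF cong_refl cong_mult[OF cong_refl cong_sym[OF qy]]])
        finally show ?thesis by (simp add: \<beta>_def \<pi>y algebra_simps)
      qed
      then show "\<exists>y\<in>K. \<forall>x\<in>K. [c x = \<beta> y x] (mod N)" using y by blast
    qed
    then show ?thesis by blast
  qed
qed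

section \<open>Duality of the subgroup lattice\<close>

lemma subgroup_lattice_self_dual:
  assumes fin: "finite (carrier G)"
  obtains f where "\<And>H. subgroup H G \<Longrightarrow> subgroup (f H) G"
    and "\<And>H. subgroup H G \<Longrightarrow> f (f H) = H"
    and "\<And>H K. H \<subseteq> K \<Longrightarrow> f K \<subseteq> f H"
proof -
  define N where "N = int (order G)"
  have N: "N > 0" "\<And>x. x \<in> carrier G \<Longrightarrow> x [^] N = \<one>"
    using fin by (simp_all add: N_def order_gt_0_iff_finite int_pow_int pow_order_eq_1)
  obtain \<beta> where \<beta>: "perfect_pairing G N (carrier G) \<beta>"
    using perfect_pairing_exists[OF fin N subgroup_self] by blast
  define f where "f H = {x \<in> carrier G. \<forall>h\<in>H. [\<beta> h x = 0] (mod N)}" for H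
  show ?thesis
  proof
    fix H assume H: "subgroup H G"
    note HG = subgroup.mem_carrier[OF H]
    \<comment> \<open>The orthogonal complement is an intersection of kernels of characters, over a
      nonempty index set because \<open>H\<close> contains the identity.\<close>
    have "f H = carrier G \<inter> (\<Inter>h\<in>H. {x \<in> carrier G. [\<beta> h x = 0] (mod N)})"
      by (auto simp: f_def)
    also have "\<dots> = (\<Inter>h\<in>H. {x \<in> carrier G. [\<beta> h x = 0] (mod N)})"
      using subgroup.one_closed[OF H] by blast
    also have "subgroup \<dots> G"
      using mod_character_kernel[OF subgroup_self perfect_pairing_character[OF \<beta> HG]]
        subgroup.one_closed[OF H]
      by (intro subgroups_Inter) auto
    finally show "subgroup (f H) G" .
    show "f (f H) = H"
    proof
      show "H \<subseteq> f (f H)"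
      proof
        fix h assume h: "h \<in> H"
        have "[\<beta> x h = 0] (mod N)" if "x \<in> f H" for x
          using perfect_pairing_sym[OF \<beta>, of x h] that h HG[OF h] by (auto simp: f_def cong_def)
        then show "h \<in> f (f H)" unfolding f_def[of "f H"] using HG[OF h] by blast
      qed
      \<comment> \<open>A character that kills \<open>H\<close> but not \<open>x\<close> is
        represented by some \<open>y\<close>. By symmetry \<open>y\<close> is orthogonal to
        \<open>H\<close>, so it lies in \<open>f H\<close>, yet it does not pair to 0 with
        \<open>x\<close>.\<close>
      show "f (f H) \<subseteq> H"
      proof (rule ccontr)
        assume "\<not> f (f H) \<subseteq> H"
        then obtain x where x: "x \<in> f (f H)" "x \<notin> H" by blast
        then have xG: "x \<in> carrier G" by (simp add: f_def)
        obtain m :: int where m: "m > 0" "\<And>i::int. x [^] i \<in> H \<longleftrightarrow> m dvd i"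
          using subgroup_relative_order[OF fin H xG] by metis
        obtain c where c: "mod_character G N (carrier G) c" "\<And>h. h \<in> H \<Longrightarrow> [c h = 0] (mod N)"
          "m dvd N" "[c x = N div m] (mod N)"
          using mod_character_separates[OF fin N H xG m] by metis
        obtain y where y: "y \<in> carrier G" "\<And>z. z \<in> carrier G \<Longrightarrow> [c z = \<beta> y z] (mod N)"
          using perfect_pairing_represents[OF \<beta> c(1)] by metis
        have "[\<beta> h y = 0] (mod N)" if "h \<in> H" for h
          using c(2)[OF that] y(2)[OF HG[OF that]] perfect_pairing_sym[OF \<beta> y(1) HG[OF that]]
          by (simp add: cong_def)
        then have "y \<in> f H" using y(1) by (simp add: f_def)
        then have "[\<beta> y x = 0] (mod N)" using x(1) unfolding f_def[of "f H"] by blast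
        then have "[N div m = 0] (mod N)"
          using c(4) y(2)[OF xG] by (simp add: cong_def)
        moreover have "m \<noteq> 1" using m(2)[of 1] x(2) xG by auto
        then have "0 < N div m" "N div m < N"
          using m(1) c(3) N(1) by (auto elim!: dvdE simp: zero_less_mult_iff)
        ultimately show False by (simp add: cong_0_iff zdvd_not_zless)
      qed
    qed
  next
    fix H K :: "'a set" assume "H \<subseteq> K"
    then show "f K \<subseteq> f H" by (auto simp: f_def)
  qed
qed

text \<open>An antitone involution exchanges bottom and top: applying \<open>f\<close> to the
  inclusion of \<open>{\<one>}\<close> in \<open>f (carrier G)\<close> gives the nontrivial
  inclusion.\<close>

lemma dual_trivial:
  assumes f: "\<And>H. subgroup H G \<Longrightarrow> subgroup (f H) G" "\<And>H. subgroup H G \<Longrightarrow> f (f H) = H"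
      "\<And>H K. H \<subseteq> K \<Longrightarrow> f K \<subseteq> f H"
  shows "f {\<one>} = carrier G"
proof (rule antisym)
  show "f {\<one>} \<subseteq> carrier G" using subgroup.subset[OF f(1)[OF triv_subgroup]] .
  show "carrier G \<subseteq> f {\<one>}"
    using f(3)[of "{\<one>}" "f (carrier G)"] f(2)[OF subgroup_self]
      subgroup.one_closed[OF f(1)[OF subgroup_self]] by simp
qed

text \<open>In an abelian group the product of two subgroups is their join, and an antitone
  involution exchanges meets with joins and bottom with top.\<close>

lemma dual_Int_trivial_iff:
  assumes f: "\<And>H. subgroup H G \<Longrightarrow> subgroup (f H) G" "\<And>H. subgroup H G \<Longrightarrow> f (f H) = H"
      "\<And>H K. H \<subseteq> K \<Longrightarrow> f K \<subseteq> f H"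
    and H: "subgroup H G" and K: "subgroup K G"
  shows "H \<inter> K = {\<one>} \<longleftrightarrow> f H <#> f K = carrier G"
proof -
  have least: "{\<one>} \<subseteq> L" "L \<subseteq> carrier G" if "subgroup L G" for L
    using that by (auto dest: subgroup.one_closed subgroup.mem_carrier)
  have fone: "f {\<one>} = carrier G" using f by (rule dual_trivial)
  let ?M = "f H <#> f K"
  have M: "subgroup ?M G" using mult_subgroups[OF f(1)[OF H] f(1)[OF K]] .
  have sub: "f H \<subseteq> ?M" "f K \<subseteq> ?M"
  proof -
    show "f H \<subseteq> ?M"
    proof
      fix x assume x: "x \<in> f H"
      have "x \<otimes> \<one> \<in> ?M" using x subgroup.one_closed[OF f(1)[OF K]] unfolding set_mult_def by blast
      then show "x \<in> ?M" using subgroup.mem_carrier[OF f(1)[OF H] x] by simp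
    qed
    show "f K \<subseteq> ?M"
    proof
      fix x assume x: "x \<in> f K"
      have "\<one> \<otimes> x \<in> ?M" using x subgroup.one_closed[OF f(1)[OF H]] unfolding set_mult_def by blast
      then show "x \<in> ?M" using subgroup.mem_carrier[OF f(1)[OF K] x] by simp
    qed
  qed
  show ?thesis
  proof
    assume HK: "H \<inter> K = {\<one>}"
    \<comment> \<open>The product contains \<open>f H\<close> and \<open>f K\<close>, so its dual
      lies in both \<open>f (f H) = H\<close> and \<open>f (f K) = K\<close>.\<close>
    have "f ?M \<subseteq> {\<one>}" using f(3)[OF sub(1)] f(3)[OF sub(2)] f(2) H K HK by auto
    then have "f ?M = {\<one>}" using least(1)[OF f(1)[OF M]] by blast
    then show "?M = carrier G" using f(2)[OF M] fone by simp
  next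
    assume M: "?M = carrier G"
    have HK: "subgroup (H \<inter> K) G" using subgroups_Inter_pair[OF H K] .
    have "f H \<subseteq> f (H \<inter> K)" "f K \<subseteq> f (H \<inter> K)" by (intro f(3) Int_lower1 Int_lower2)+
    then have "?M \<subseteq> f (H \<inter> K)"
      using subgroup.m_closed[OF f(1)[OF HK]] by (auto simp: set_mult_def)
    then have "f (H \<inter> K) = f {\<one>}"
      unfolding fone M using least(2)[OF f(1)[OF HK]] by (rule antisym[rotated])
    then have "f (f (H \<inter> K)) = f (f {\<one>})" by (rule arg_cong)
    then show "H \<inter> K = {\<one>}" unfolding f(2)[OF HK] f(2)[OF triv_subgroup] .
  qed
qed

end

section \<open>Transfer to the hypergraphs\<close>

text \<open>Hyperedges are maximal cliques of a relation on the vertices, and a bijection that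
  carries one relation to the other carries maximal cliques to maximal cliques. Competing cliques in
  \<open>W\<close> are covered because every subset of \<open>W\<close> is the image of a subset of
  \<open>V\<close>.\<close>

lemma maximal_pairwise_image_iff:
  assumes bij: "bij_betw f V W" and A: "A \<subseteq> V"
    and RS: "\<And>x y. x \<in> V \<Longrightarrow> y \<in> V \<Longrightarrow> R x y \<longleftrightarrow> S (f x) (f y)"
  shows "(A \<subseteq> V \<and> pairwise R A \<and> \<not> (\<exists>B. B \<subseteq> V \<and> A \<subset> B \<and> pairwise R B)) \<longleftrightarrow>
    (f ` A \<subseteq> W \<and> pairwise S (f ` A) \<and> \<not> (\<exists>B. B \<subseteq> W \<and> f ` A \<subset> B \<and> pairwise S B))"
proof -
  have inj: "inj_on f V" and W: "W = f ` V" using bij by (auto simp: bij_betw_def)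
  have pw: "pairwise R B \<longleftrightarrow> pairwise S (f ` B)" if "B \<subseteq> V" for B
  proof -
    have "R x y \<longleftrightarrow> S (f x) (f y)" "f x = f y \<longleftrightarrow> x = y" if "x \<in> B" "y \<in> B" for x y
      using RS[of x y] inj_on_eq_iff[OF inj, of x y] \<open>B \<subseteq> V\<close> that by auto
    then show ?thesis by (simp add: pairwise_image pairwise_def)
  qed
  have psub: "A \<subset> B \<longleftrightarrow> f ` A \<subset> f ` B" if "B \<subseteq> V" for B
  proof -
    have "A \<subseteq> B \<longleftrightarrow> f ` A \<subseteq> f ` B"
      using inj_on_image_mem_iff[OF inj _ that] A unfolding image_subset_iff by blast
    then show ?thesis
      unfolding psubset_eq using inj_on_image_eq_iff[OF inj A that] by simp
  qed
  have "(\<exists>B. B \<subseteq> V \<and> A \<subset> B \<and> pairwise R B) \<longleftrightarrow> (\<exists>B. B \<subseteq> V \<and> f ` A \<subset> f ` B \<and> pairwise S (f ` B))"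
    using pw psub by (intro ex_cong1 conj_cong) simp_all
  also have "\<dots> \<longleftrightarrow> (\<exists>B. B \<subseteq> W \<and> f ` A \<subset> B \<and> pairwise S B)"
    using all_subset_image[of f V "\<lambda>B. \<not> (f ` A \<subset> B \<and> pairwise S B)"] unfolding W by metis
  finally show ?thesis using pw[OF A] A W by (simp add: image_mono)
qed

theorem theorem2p3:
  fixes G :: "('a, 'b) monoid_scheme"
  assumes "comm_group G" and "finite (carrier G)"
  shows "hypergraph_iso (intersection_hypergraph G) (comaximal_hypergraph G)"
proof -
  interpret comm_group G by fact
  let ?S = "nontrivial_proper_subgroups G"
  obtain f where f: "\<And>H. subgroup H G \<Longrightarrow> subgroup (f H) G" "\<And>H. subgroup H G \<Longrightarrow> f (f H) = H"
      "\<And>H K. H \<subseteq> K \<Longrightarrow> f K \<subseteq> f H"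
    using subgroup_lattice_self_dual[OF assms(2)] by metis
  have Ssub: "subgroup H G" if "H \<in> ?S" for H
    using that by (simp add: nontrivial_proper_subgroups_def)
  have iff: "H \<inter> K = {\<one>\<^bsub>G\<^esub>} \<longleftrightarrow> f H <#>\<^bsub>G\<^esub> f K = carrier G" if "H \<in> ?S" "K \<in> ?S" for H K
    using dual_Int_trivial_iff[OF f Ssub[OF that(1)] Ssub[OF that(2)]] .
  have fone: "f {\<one>\<^bsub>G\<^esub>} = carrier G" using f by (rule dual_trivial)
  \<comment> \<open>As \<open>f\<close> is an involution swapping \<open>{\<one>}\<close> and the
    whole group, it cannot send any other subgroup to one of these two.\<close>
  have fS: "f H \<in> ?S" if "H \<in> ?S" for H
  proof -
    have "f H \<noteq> {\<one>\<^bsub>G\<^esub>}" "f H \<noteq> carrier G"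
      using that f(2)[OF Ssub[OF that]] fone f(2)[OF triv_subgroup]
      by (auto simp: nontrivial_proper_subgroups_def)
    then show ?thesis using f(1)[OF Ssub[OF that]] by (simp add: nontrivial_proper_subgroups_def)
  qed
  have ffS: "f (f H) = H" if "H \<in> ?S" for H using f(2)[OF Ssub[OF that]] .
  have Vsub: "intersection_vertices G \<subseteq> ?S" "comaximal_vertices G \<subseteq> ?S"
    by (auto simp: intersection_vertices_def comaximal_vertices_def)
  have bij: "bij_betw f (intersection_vertices G) (comaximal_vertices G)"
  \<comment> \<open>The map \<open>f\<close> is its own inverse on \<open>?S\<close>, so only the
    two image inclusions have to be checked; in each, the dual of a witness \<open>K\<close> for
    \<open>H\<close> is a witness for \<open>f H\<close>.\<close>
  proof (rule bij_betw_byWitness[where f' = f])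
    show "f ` intersection_vertices G \<subseteq> comaximal_vertices G"
    proof clarify
      fix H assume "H \<in> intersection_vertices G"
      then obtain K where HK: "H \<in> ?S" "K \<in> ?S" "H \<inter> K = {\<one>\<^bsub>G\<^esub>}"
        by (auto simp: intersection_vertices_def)
      then have "f H <#>\<^bsub>G\<^esub> f K = carrier G" using iff by simp
      then show "f H \<in> comaximal_vertices G"
        using HK fS by (auto simp: comaximal_vertices_def)
    qed
    show "f ` comaximal_vertices G \<subseteq> intersection_vertices G"
    proof clarify
      fix H assume "H \<in> comaximal_vertices G"
      then obtain K where HK: "H \<in> ?S" "K \<in> ?S" "H <#>\<^bsub>G\<^esub> K = carrier G"
        by (auto simp: comaximal_vertices_def)
      then have "f H \<inter> f K = {\<one>\<^bsub>G\<^esub>}" using iff[OF fS fS, of H K] ffS by simp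
      then show "f H \<in> intersection_vertices G"
        using HK fS by (auto simp: intersection_vertices_def)
    qed
  qed (use ffS Vsub in auto)
  show ?thesis
    unfolding hypergraph_iso_def
  proof (intro exI conjI allI impI)
    show "bij_betw f (vertices (intersection_hypergraph G)) (vertices (comaximal_hypergraph G))"
      using bij by (simp add: intersection_hypergraph_def comaximal_hypergraph_def)
    fix A assume "A \<subseteq> vertices (intersection_hypergraph G)"
    then have A: "A \<subseteq> intersection_vertices G" by (simp add: intersection_hypergraph_def)
    show "A \<in> hyperedges (intersection_hypergraph G) \<longleftrightarrow> f ` A \<in> hyperedges (comaximal_hypergraph G)"
      unfolding intersection_hypergraph_def comaximal_hypergraph_def
        hypergraph.select_convs mem_Collect_eq
      by (rule maximal_pairwise_image_iff[OF bij A]) (use iff Vsub(1) in \<open>simp add: subset_iff\<close>)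
  qed
qed

end
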